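(* Consider a sufficiently complex least squares support vector machine (LS-SVM) trained on points drawn from a finite alphabet $\mathcal C$. For each $S$ let $(\bm w_S,b_S)$ be a global minimizer of the LS-SVM objective $\omega(\bm w,b)$ built on the first $S$ training points, and let $\tilde t(\bm\alpha)=\lim_{S\to\infty}\big(\bm w_S^T\phi(\bm\alpha)+b_S\big)$, $\bm\alpha\in\mathcal C$ (limit in probability), be the function obtained with an infinite number of training points. For a threshold $\lambda\in\mathbb{R}$ define the test function $f(\bm\alpha)=1$ if $\tilde t(\bm\alpha)>\lambda$ and $f(\bm\alpha)=-1$ if $\tilde t(\bm\alpha)\le\lambda$. Then $f$ is a Neyman-Pearson test: there is a threshold $\Lambda\in[-\infty,+\infty]$ such that $f(\bm\alpha)=f^*_\Lambda(\bm\alpha)$ for all $\bm\alpha\in\mathcal C$. Thus $f$ is the most powerful test for its false alarm probability.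
   Context: Setting (two-class problem). $\mathcal C\subset\mathbb{R}^N$ is a finite set. A state $\mathcal H\in\{\mathcal H_0,\mathcal H_1\}$ is random with $\mathbb P(\mathcal H=\mathcal H_0)>0$ and $\mathbb P(\mathcal H=\mathcal H_1)>0$. An observation $\bm a\in\mathcal C$ has conditional probability mass function $p(\bm\alpha|\mathcal H_i)>0$, $\bm\alpha\in\mathcal C$, given $\mathcal H=\mathcal H_i$, $i=0,1$. The label is $t=-1$ if $\mathcal H=\mathcal H_0$ and $t=1$ if $\mathcal H=\mathcal H_1$. Training points $(\bm a^{(i)},t_i)$, $i=1,2,\dots$, are drawn independently with the law of $(\bm a,t)$. Tests. A test decides $\hat{\mathcal H}=\mathcal H_0$ when its value is $-1$ and $\hat{\mathcal H}=\mathcal H_1$ when its value is $1$. Its false alarm and mis-detection probabilities are $P_{\rm FA}=\mathbb P(\hat{\mathcal H}=\mathcal H_1|\mathcal H=\mathcal H_0)$ and $P_{\rm MD}=\mathbb P(\hat{\mathcal H}=\mathcal H_0|\mathcal H=\mathcal H_1)$. A test $f$ is most powerful for its false alarm probability if every test with false alarm probability at most $P_{\rm FA}(f)$ has mis-detection probability at least $P_{\rm MD}(f)$. Neyman-Pearson test. The log likelihood-ratio is $\mathcal M(\bm\alpha)=\ln\frac{p(\bm\alpha|\mathcal H_0)}{p(\bm\alpha|\mathcal H_1)}$. The Neyman-Pearson test with threshold $\Lambda$ is $f^*_\Lambda(\bm\alpha)=-1$ if $\mathcal M(\bm\alpha)\ge\Lambda$ and $f^*_\Lambda(\bm\alpha)=1$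 if $\mathcal M(\bm\alpha)<\Lambda$. LS-SVM. Given a fixed feature map $\phi:\mathbb{R}^N\to\mathbb{R}^K$ and a fixed constant $C>0$, the LS-SVM implements the function $\bm a\mapsto\bm w^T\phi(\bm a)+b$ with $\bm w\in\mathbb{R}^K$, $b\in\mathbb{R}$, and is trained on $S$ points by minimizing over $(\bm w,b)$ $$\omega(\bm w,b)=\frac12\bm w^T\bm w+\frac C2\sum_{i=1}^S e_i^2,\qquad e_i=t_i[\bm w^T\phi(\bm a^{(i)})+b]-1,\quad i=1,\dots,S.$$ "Sufficiently complex" means that every function $\mathcal C\to\mathbb{R}$ is of the form $\bm\alpha\mapsto\bm w^T\phi(\bm\alpha)+b$ for some $\bm w\in\mathbb{R}^K$, $b\in\mathbb{R}$. *)

theory Defs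
  imports "HOL-Probability.Probability"
begin

datatype hypothesis = H0 | H1

fun label :: "hypothesis \<Rightarrow> real" where
  "label H0 = -1"
| "label H1 = 1"

text \<open>Throughout, \<open>M\<close> is a probability space carrying the random state \<open>H\<close> and the random
  observation \<open>a\<close>.\<close>

definition obs_pmf ::
    "'w measure \<Rightarrow> ('w \<Rightarrow> hypothesis) \<Rightarrow> ('w \<Rightarrow> 'x) \<Rightarrow> hypothesis \<Rightarrow> 'x \<Rightarrow> real" where
  "obs_pmf M H a h \<alpha> = \<P>(\<omega> in M. a \<omega> = \<alpha> \<bar> H \<omega> = h)"

text \<open>A test is a non-randomized function on the alphabet; the value \<open>-1\<close> stands for the
  decision \<open>H0\<close> and the value \<open>1\<close> for the decision \<open>H1\<close>. Values off the alphabet are irrelevant.\<close>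

definition is_test :: "'x set \<Rightarrow> ('x \<Rightarrow> real) \<Rightarrow> bool" where
  "is_test \<C> g \<longleftrightarrow> (\<forall>\<alpha>\<in>\<C>. g \<alpha> \<in> {-1, 1})"

definition false_alarm ::
    "'w measure \<Rightarrow> ('w \<Rightarrow> hypothesis) \<Rightarrow> ('w \<Rightarrow> 'x) \<Rightarrow> ('x \<Rightarrow> real) \<Rightarrow> real" where
  "false_alarm M H a g = \<P>(\<omega> in M. g (a \<omega>) = 1 \<bar> H \<omega> = H0)"

definition mis_detection ::
    "'w measure \<Rightarrow> ('w \<Rightarrow> hypothesis) \<Rightarrow> ('w \<Rightarrow> 'x) \<Rightarrow> ('x \<Rightarrow> real) \<Rightarrow> real" where
  "mis_detection M H a g = \<P>(\<omega> in M. g (a \<omega>) = -1 \<bar> H \<omega> = H1)"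

definition most_powerful ::
    "'w measure \<Rightarrow> ('w \<Rightarrow> hypothesis) \<Rightarrow> ('w \<Rightarrow> 'x) \<Rightarrow> 'x set \<Rightarrow> ('x \<Rightarrow> real) \<Rightarrow> bool" where
  "most_powerful M H a \<C> f \<longleftrightarrow>
     is_test \<C> f \<and>
     (\<forall>g. is_test \<C> g \<and> false_alarm M H a g \<le> false_alarm M H a f
          \<longrightarrow> mis_detection M H a f \<le> mis_detection M H a g)"

definition log_lr ::
    "'w measure \<Rightarrow> ('w \<Rightarrow> hypothesis) \<Rightarrow> ('w \<Rightarrow> 'x) \<Rightarrow> 'x \<Rightarrow> real" where
  "log_lr M H a \<alpha> = ln (obs_pmf M H a H0 \<alpha> / obs_pmf M H a H1 \<alpha>)"

definition np_test ::
    "'w measure \<Rightarrow> ('w \<Rightarrow> hypothesis) \<Rightarrow> ('w \<Rightarrow> 'x) \<Rightarrow> ereal \<Rightarrow> 'x \<Rightarrow> real" where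
  "np_test M H a \<Lambda> \<alpha> = (if ereal (log_lr M H a \<alpha>) \<ge> \<Lambda> then -1 else 1)"

definition threshold_test :: "('x \<Rightarrow> real) \<Rightarrow> real \<Rightarrow> 'x \<Rightarrow> real" where
  "threshold_test t \<theta> \<alpha> = (if t \<alpha> > \<theta> then 1 else -1)"

definition ls_svm :: "('x \<Rightarrow> real^'k) \<Rightarrow> (real^'k) \<times> real \<Rightarrow> 'x \<Rightarrow> real" where
  "ls_svm \<phi> = (\<lambda>(w, b) \<alpha>. w \<bullet> \<phi> \<alpha> + b)"

definition sufficiently_complex :: "('x \<Rightarrow> real^'k) \<Rightarrow> 'x set \<Rightarrow> bool" where
  "sufficiently_complex \<phi> \<C> \<longleftrightarrow>
     (\<forall>h :: 'x \<Rightarrow> real. \<exists>w b. \<forall>\<alpha>\<in>\<C>. h \<alpha> = ls_svm \<phi> (w, b) \<alpha>)"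

text \<open>The LS-SVM objective for the training points \<open>(x i, t i)\<close>, \<open>i = 1, \<dots>, S\<close>; the sequences
  are given in full, but only their first \<open>S\<close> members are used.\<close>

definition ls_svm_objective ::
    "('x \<Rightarrow> real^'k) \<Rightarrow> real \<Rightarrow> nat \<Rightarrow> (nat \<Rightarrow> 'x) \<Rightarrow> (nat \<Rightarrow> real) \<Rightarrow> (real^'k) \<times> real \<Rightarrow> real" where
  "ls_svm_objective \<phi> C S x t =
     (\<lambda>(w, b). 1/2 * (w \<bullet> w) + C/2 * (\<Sum>i=1..S. (t i * (w \<bullet> \<phi> (x i) + b) - 1)\<^sup>2))"

definition tendsto_in_prob :: "'w measure \<Rightarrow> (nat \<Rightarrow> 'w \<Rightarrow> real) \<Rightarrow> real \<Rightarrow> bool" where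
  "tendsto_in_prob M X c \<longleftrightarrow>
     (\<forall>\<epsilon>>0. (\<lambda>S. \<P>(\<omega> in M. \<bar>X S \<omega> - c\<bar> > \<epsilon>)) \<longlonglongrightarrow> 0)"

end

theory Submission
  imports Defs "HOL-Real_Asymp.Real_Asymp"
begin

text \<open>For labels \<open>\<plusminus>1\<close> training an LS-SVM is a ridge regression of the label on the observation.
  Comparing the minimizer with a fixed \<open>(w, b)\<close> that represents the regression function
  \<open>\<alpha> \<mapsto> E[t | a = \<alpha>]\<close> (available because the machine is sufficiently complex), the regularization
  costs only \<open>O(1/S)\<close> per sample, so by the law of large numbers the trained function converges in
  probability to the regression function at every letter. This function is a decreasing
  function of the log likelihood ratio, so thresholding it is a Neyman-Pearson test.\<close>

section \<open>Convergence in probability: weak law and uniqueness of limits\<close>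

text \<open>Hoeffding's inequality bounds the tail probability by a quantity exponentially small in
  \<open>S\<close>, which is more than convergence needs.\<close>

lemma (in prob_space) weak_law_bounded_iid:
  fixes X :: "nat \<Rightarrow> 'a \<Rightarrow> real"
  assumes indep: "indep_vars (\<lambda>_. borel) X {1..}"
    and distr: "\<And>i. i \<ge> 1 \<Longrightarrow> distr M borel (X i) = distr M borel Y"
    and Y: "random_variable borel Y"
    and bnd: "AE x in M. Y x \<in> {l..u}" and "l < u"
  shows "tendsto_in_prob M (\<lambda>S \<omega>. (\<Sum>i=1..S. X i \<omega>) / real S) (expectation Y)"
  unfolding tendsto_in_prob_def
proof (intro allI impI)
  fix \<epsilon> :: real assume "\<epsilon> > 0"
  have le: "\<P>(\<omega> in M. \<bar>(\<Sum>i=1..S. X i \<omega>) / real S - expectation Y\<bar> > \<epsilon>)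
      \<le> 2 * exp (-2 * real S * \<epsilon>\<^sup>2 / (u - l)\<^sup>2)" if "S \<ge> 1" for S
  proof -
    interpret Hoeffding_ineq_iid M "{1..S}" X Y l u "expectation Y"
      by unfold_locales (use distr Y bnd indep_vars_subset[OF indep, of "{1..S}"] in auto)
    \<comment> \<open>Convergence in probability uses the strict deviation event, Hoeffding's
      inequality the non-strict one.\<close>
    have "\<P>(\<omega> in M. \<bar>(\<Sum>i=1..S. X i \<omega>) / real S - expectation Y\<bar> > \<epsilon>)
        \<le> \<P>(\<omega> in M. \<bar>(\<Sum>i=1..S. X i \<omega>) / real S - expectation Y\<bar> \<ge> \<epsilon>)"
      by (rule finite_measure_mono) auto
    also have "\<dots> \<le> 2 * exp (-2 * real S * \<epsilon>\<^sup>2 / (u - l)\<^sup>2)"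
      using Hoeffding_ineq_abs_ge'[of \<epsilon>] \<open>\<epsilon> > 0\<close> \<open>l < u\<close> that by simp
    finally show ?thesis .
  qed
  have "(\<lambda>S. 2 * exp (-2 * real S * \<epsilon>\<^sup>2 / (u - l)\<^sup>2)) \<longlonglongrightarrow> 0"
  proof -
    define k where "k = 2 * \<epsilon>\<^sup>2 / (u - l)\<^sup>2"
    have "k > 0" using \<open>\<epsilon> > 0\<close> \<open>l < u\<close> by (simp add: k_def)
    then have "(\<lambda>S. 2 * exp (- (k * real S))) \<longlonglongrightarrow> 0" by real_asymp
    then show ?thesis by (simp add: k_def mult_ac)
  qed
  then show "(\<lambda>S. \<P>(\<omega> in M. \<bar>(\<Sum>i=1..S. X i \<omega>) / real S - expectation Y\<bar> > \<epsilon>)) \<longlonglongrightarrow> 0"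
    by (rule tendsto_sandwich[rotated 3, where f = "\<lambda>_. 0"])
       (use le in \<open>auto intro!: eventually_sequentiallyI[of 1]\<close>)
qed

text \<open>If the limits differed, every outcome would be farther than a third of their distance
  from one of them. The two deviation probabilities would then always add up to at least 1, yet both
  vanish.\<close>

lemma (in prob_space) tendsto_in_prob_unique:
  assumes meas: "\<And>S. S \<ge> 1 \<Longrightarrow> random_variable borel (X S)"
    and "tendsto_in_prob M X c" "tendsto_in_prob M X d"
  shows "c = d"
proof (rule ccontr)
  assume "c \<noteq> d"
  define \<epsilon> where "\<epsilon> = \<bar>c - d\<bar> / 3"
  have \<epsilon>: "\<epsilon> > 0" "\<bar>c - d\<bar> > 2 * \<epsilon>" using \<open>c \<noteq> d\<close> by (auto simp: \<epsilon>_def)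
  have "(\<lambda>S. \<P>(\<omega> in M. \<bar>X S \<omega> - c\<bar> > \<epsilon>) + \<P>(\<omega> in M. \<bar>X S \<omega> - d\<bar> > \<epsilon>)) \<longlonglongrightarrow> 0"
    using assms(2,3) \<epsilon>(1) unfolding tendsto_in_prob_def by (intro tendsto_add_zero) auto
  moreover have "1 \<le> \<P>(\<omega> in M. \<bar>X S \<omega> - c\<bar> > \<epsilon>) + \<P>(\<omega> in M. \<bar>X S \<omega> - d\<bar> > \<epsilon>)" if "S \<ge> 1" for S
  proof -
    note [measurable] = meas[OF that]
    have "1 = prob ({\<omega>\<in>space M. \<bar>X S \<omega> - c\<bar> > \<epsilon>} \<union> {\<omega>\<in>space M. \<bar>X S \<omega> - d\<bar> > \<epsilon>})"
      by (subst prob_space[symmetric], rule arg_cong[where f = prob]) (use \<epsilon> in auto)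
    also have "\<dots> \<le> \<P>(\<omega> in M. \<bar>X S \<omega> - c\<bar> > \<epsilon>) + \<P>(\<omega> in M. \<bar>X S \<omega> - d\<bar> > \<epsilon>)"
      by (rule measure_Un_le) auto
    finally show ?thesis .
  qed
  ultimately have "(1::real) \<le> 0"
    by (intro LIMSEQ_le_const[where a = 1 and x = 0]) auto
  then show False by simp
qed

section \<open>Deviation of the trained function from a fixed competitor\<close>

text \<open>Completing the square turns each term into
  \<open>m/2 * (d i)\<^sup>2 - 2/m * (r i)\<^sup>2\<close> plus a nonnegative quantity.\<close>

lemma quadratic_form_bound:
  fixes q r d :: "'i \<Rightarrow> real"
  assumes "finite I" "m > 0" "j \<in> I"
    and q: "\<And>i. i \<in> I \<Longrightarrow> q i \<ge> m" and r: "\<And>i. i \<in> I \<Longrightarrow> \<bar>r i\<bar> \<le> \<delta>"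
    and le: "(\<Sum>i\<in>I. q i * (d i)\<^sup>2 + 2 * d i * r i) \<le> K"
  shows "(d j)\<^sup>2 \<le> 2 / m * (K + 2 * real (card I) * \<delta>\<^sup>2 / m)"
proof -
  have "m / 2 * (d j)\<^sup>2 \<le> (\<Sum>i\<in>I. m / 2 * (d i)\<^sup>2)"
    using assms by (intro member_le_sum) auto
  also have "\<dots> \<le> (\<Sum>i\<in>I. (q i * (d i)\<^sup>2 + 2 * d i * r i) + 2 * \<delta>\<^sup>2 / m)"
  proof (rule sum_mono)
    fix i assume i: "i \<in> I"
    have "m * (d i)\<^sup>2 \<le> q i * (d i)\<^sup>2" using q[OF i] by (intro mult_right_mono) auto
    moreover have "2 * (r i)\<^sup>2 / m \<le> 2 * \<delta>\<^sup>2 / m"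
      using r[OF i] \<open>m > 0\<close> by (intro divide_right_mono) (auto simp flip: abs_le_square_iff)
    moreover have "0 \<le> m / 2 * (d i + 2 * r i / m)\<^sup>2" using \<open>m > 0\<close> by simp
    moreover have "m / 2 * (d i + 2 * r i / m)\<^sup>2 = m / 2 * (d i)\<^sup>2 + 2 * d i * r i + 2 * (r i)\<^sup>2 / m"
      using \<open>m > 0\<close> by (simp add: power2_eq_square field_simps)
    ultimately show "m / 2 * (d i)\<^sup>2 \<le> (q i * (d i)\<^sup>2 + 2 * d i * r i) + 2 * \<delta>\<^sup>2 / m" by linarith
  qed
  also have "\<dots> = (\<Sum>i\<in>I. q i * (d i)\<^sup>2 + 2 * d i * r i) + real (card I) * (2 * \<delta>\<^sup>2 / m)"
    by (simp add: sum.distrib)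
  also have "\<dots> \<le> K + 2 * real (card I) * \<delta>\<^sup>2 / m" using le by (simp add: mult_ac)
  finally show ?thesis using \<open>m > 0\<close> by (simp add: field_simps)
qed

text \<open>For labels \<open>\<plusminus>1\<close> the error \<open>t * y - 1\<close> has the same square as \<open>y - t\<close>.\<close>

lemma ls_svm_minimizer_bound:
  fixes \<phi> :: "'x \<Rightarrow> real^'k" and w0 :: "real^'k" and b0 :: real
  assumes "finite \<C>" "C > 0"
    and x: "\<And>i. i \<ge> 1 \<Longrightarrow> x i \<in> \<C>" and t: "\<And>i. i \<ge> 1 \<Longrightarrow> t i \<in> {-1, 1}"
    and min: "is_arg_min (ls_svm_objective \<phi> C S x t) (\<lambda>_. True) (w, b)"
  defines "d \<equiv> \<lambda>\<alpha>. ls_svm \<phi> (w, b) \<alpha> - ls_svm \<phi> (w0, b0) \<alpha>"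
  shows "(\<Sum>\<alpha>\<in>\<C>. (\<Sum>i=1..S. of_bool (x i = \<alpha>)) / real S * (d \<alpha>)\<^sup>2
      + 2 * d \<alpha> * ((\<Sum>i=1..S. of_bool (x i = \<alpha>) * (ls_svm \<phi> (w0, b0) \<alpha> - t i)) / real S))
    \<le> (w0 \<bullet> w0) / C / real S"
proof -
  define y y0 where "y = ls_svm \<phi> (w, b)" and "y0 = ls_svm \<phi> (w0, b0)"
  have obj: "ls_svm_objective \<phi> C S x t (v, c)
      = 1/2 * (v \<bullet> v) + C/2 * (\<Sum>i=1..S. (ls_svm \<phi> (v, c) (x i) - t i)\<^sup>2)" for v c
  proof -
    have "(t i * (v \<bullet> \<phi> (x i) + c) - 1)\<^sup>2 = (ls_svm \<phi> (v, c) (x i) - t i)\<^sup>2" if "i \<in> {1..S}" for i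
      using t[of i] that by (auto simp: ls_svm_def power2_eq_square algebra_simps)
    then show ?thesis by (simp add: ls_svm_objective_def)
  qed
  have "ls_svm_objective \<phi> C S x t (w, b) \<le> ls_svm_objective \<phi> C S x t (w0, b0)"
    using min by (auto simp: is_arg_min_linorder)
  then have "1/2 * (w \<bullet> w) + C/2 * ((\<Sum>i=1..S. (y (x i) - t i)\<^sup>2) - (\<Sum>i=1..S. (y0 (x i) - t i)\<^sup>2))
      \<le> 1/2 * (w0 \<bullet> w0)"
    by (simp add: obj y_def y0_def algebra_simps)
  moreover have "0 \<le> w \<bullet> w" by simp
  ultimately have "C * ((\<Sum>i=1..S. (y (x i) - t i)\<^sup>2) - (\<Sum>i=1..S. (y0 (x i) - t i)\<^sup>2)) \<le> w0 \<bullet> w0"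
    by linarith
  then have le: "(\<Sum>i=1..S. (y (x i) - t i)\<^sup>2) - (\<Sum>i=1..S. (y0 (x i) - t i)\<^sup>2) \<le> (w0 \<bullet> w0) / C"
    using \<open>C > 0\<close> by (simp add: field_simps)
  \<comment> \<open>The loss difference is regrouped by letter. At each sample point it equals
    \<open>d\<^sup>2 + 2 * d * (y0 - t)\<close>, so the letter frequencies become the quadratic
    coefficients and the residuals of \<open>y0\<close> the linear ones.\<close>
  have "(\<Sum>i=1..S. (y (x i) - t i)\<^sup>2) - (\<Sum>i=1..S. (y0 (x i) - t i)\<^sup>2)
      = (\<Sum>i=1..S. \<Sum>\<alpha>\<in>\<C>. of_bool (x i = \<alpha>) * ((d \<alpha>)\<^sup>2 + 2 * d \<alpha> * (y0 \<alpha> - t i)))"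
    unfolding sum_subtractf[symmetric]
  proof (rule sum.cong[OF refl])
    fix i assume "i \<in> {1..S}"
    then have "(\<Sum>\<alpha>\<in>\<C>. of_bool (x i = \<alpha>) * ((d \<alpha>)\<^sup>2 + 2 * d \<alpha> * (y0 \<alpha> - t i)))
        = (d (x i))\<^sup>2 + 2 * d (x i) * (y0 (x i) - t i)"
      using x[of i] \<open>finite \<C>\<close> by (simp add: of_bool_def if_distrib[where f = "\<lambda>c. c * _"] cong: if_cong)
    also have "\<dots> = (y (x i) - t i)\<^sup>2 - (y0 (x i) - t i)\<^sup>2"
      by (simp add: d_def y_def y0_def power2_eq_square algebra_simps)
    finally show "(y (x i) - t i)\<^sup>2 - (y0 (x i) - t i)\<^sup>2
        = (\<Sum>\<alpha>\<in>\<C>. of_bool (x i = \<alpha>) * ((d \<alpha>)\<^sup>2 + 2 * d \<alpha> * (y0 \<alpha> - t i)))" ..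
  qed
  also have "\<dots> = (\<Sum>\<alpha>\<in>\<C>. (\<Sum>i=1..S. of_bool (x i = \<alpha>)) * (d \<alpha>)\<^sup>2
      + 2 * d \<alpha> * (\<Sum>i=1..S. of_bool (x i = \<alpha>) * (y0 \<alpha> - t i)))"
    unfolding sum_distrib_right sum_distrib_left sum.distrib[symmetric]
    by (subst sum.swap) (intro sum.cong refl, simp add: algebra_simps)
  \<comment> \<open>For \<open>S = 0\<close> both sides are 0, since division by zero yields
    0.\<close>
  finally have "(\<Sum>\<alpha>\<in>\<C>. (\<Sum>i=1..S. of_bool (x i = \<alpha>)) * (d \<alpha>)\<^sup>2
      + 2 * d \<alpha> * (\<Sum>i=1..S. of_bool (x i = \<alpha>) * (y0 \<alpha> - t i))) / real S \<le> (w0 \<bullet> w0) / C / real S"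
    using le by (intro divide_right_mono) auto
  then show ?thesis
    by (simp add: sum_divide_distrib[where A = \<C>] add_divide_distrib y0_def)
qed

text \<open>Once all letter frequencies are close to their positive limits and all averaged
  residuals are small, the minimizer bound forces the deviation at \<open>\<beta>\<close> below
  \<open>\<epsilon>\<close>. The exceptional event is a union, over finitely many letters, of events
  of vanishing probability.\<close>

lemma ls_svm_tendsto_in_prob:
  fixes \<phi> :: "'x \<Rightarrow> real^'k"
  assumes "prob_space M" and fin: "finite \<C>" and C: "C > 0"
    and AT: "\<And>i \<omega>. i \<ge> 1 \<Longrightarrow> \<omega> \<in> space M \<Longrightarrow> A i \<omega> \<in> \<C> \<and> T i \<omega> \<in> {-1, 1}"
    and min: "\<And>S \<omega>. S \<ge> 1 \<Longrightarrow> \<omega> \<in> space M \<Longrightarrow>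
           is_arg_min (ls_svm_objective \<phi> C S (\<lambda>i. A i \<omega>) (\<lambda>i. T i \<omega>)) (\<lambda>_. True) (w S \<omega>, b S \<omega>)"
    and measA: "\<And>\<alpha> i. \<alpha> \<in> \<C> \<Longrightarrow> i \<ge> 1 \<Longrightarrow> (\<lambda>\<omega>. of_bool (A i \<omega> = \<alpha>) :: real) \<in> borel_measurable M"
    and measT: "\<And>i. i \<ge> 1 \<Longrightarrow> T i \<in> borel_measurable M"
    and y0: "\<And>\<alpha>. \<alpha> \<in> \<C> \<Longrightarrow> ls_svm \<phi> (w0, b0) \<alpha> = \<tau> \<alpha>"
    and qpos: "\<And>\<alpha>. \<alpha> \<in> \<C> \<Longrightarrow> q \<alpha> > 0"
    and limq: "\<And>\<alpha>. \<alpha> \<in> \<C> \<Longrightarrow> tendsto_in_prob M (\<lambda>S \<omega>. (\<Sum>i=1..S. of_bool (A i \<omega> = \<alpha>)) / real S) (q \<alpha>)"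
    and limr: "\<And>\<alpha>. \<alpha> \<in> \<C> \<Longrightarrow>
      tendsto_in_prob M (\<lambda>S \<omega>. (\<Sum>i=1..S. of_bool (A i \<omega> = \<alpha>) * (\<tau> \<alpha> - T i \<omega>)) / real S) 0"
    and \<beta>: "\<beta> \<in> \<C>"
  shows "tendsto_in_prob M (\<lambda>S \<omega>. ls_svm \<phi> (w S \<omega>, b S \<omega>) \<beta>) (\<tau> \<beta>)"
  unfolding tendsto_in_prob_def
proof (intro allI impI)
  fix \<epsilon> :: real assume "\<epsilon> > 0"
  interpret prob_space M by fact
  \<comment> \<open>Half of the smallest limit frequency: an empirical frequency within
    \<open>m\<close> of its limit is still at least \<open>m\<close>.\<close>
  define m where "m = Min (q ` \<C>) / 2"
  have "\<C> \<noteq> {}" using \<beta> by auto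
  then have m: "m > 0" using fin qpos by (simp add: m_def)
  have qm: "q \<alpha> \<ge> 2 * m" if "\<alpha> \<in> \<C>" for \<alpha> using that fin by (simp add: m_def)
  \<comment> \<open>Chosen so that the residuals of all letters together contribute less than
    \<open>\<epsilon>\<^sup>2 / 2\<close> to the bound on the squared deviation; see
    \<open>small\<close>.\<close>
  define \<delta> where "\<delta> = \<epsilon> * m / (4 * (1 + real (card \<C>)))"
  have \<delta>: "\<delta> > 0" using \<open>\<epsilon> > 0\<close> m by (simp add: \<delta>_def)
  define K where "K = (w0 \<bullet> w0) / C"
  define Q where "Q \<alpha> S \<omega> = (\<Sum>i=1..S. of_bool (A i \<omega> = \<alpha>)) / real S" for \<alpha> S \<omega>
  define R where "R \<alpha> S \<omega> = (\<Sum>i=1..S. of_bool (A i \<omega> = \<alpha>) * (\<tau> \<alpha> - T i \<omega>)) / real S" for \<alpha> S \<omega>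
  have Q[measurable]: "Q \<alpha> S \<in> borel_measurable M" if "\<alpha> \<in> \<C>" for \<alpha> S
    unfolding Q_def using that measA by (intro borel_measurable_divide borel_measurable_sum) auto
  have R[measurable]: "R \<alpha> S \<in> borel_measurable M" if "\<alpha> \<in> \<C>" for \<alpha> S
    unfolding R_def using that measA measT
    by (intro borel_measurable_divide borel_measurable_sum borel_measurable_times borel_measurable_diff) auto
  let ?bQ = "\<lambda>\<alpha> S. {\<omega>\<in>space M. \<bar>Q \<alpha> S \<omega> - q \<alpha>\<bar> > m}"
  let ?bR = "\<lambda>\<alpha> S. {\<omega>\<in>space M. \<bar>R \<alpha> S \<omega> - 0\<bar> > \<delta>}"
  have small: "2 / m * (2 * real (card \<C>) * \<delta>\<^sup>2 / m) < \<epsilon>\<^sup>2 / 2"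
  proof -
    define n where "n = real (card \<C>)"
    have n: "n \<ge> 0" by (simp add: n_def)
    have "2 / m * (2 * n * \<delta>\<^sup>2 / m) = \<epsilon>\<^sup>2 * (n / (4 * (1 + n)\<^sup>2))"
      using m n by (simp add: \<delta>_def n_def[symmetric] power2_eq_square divide_simps) (simp add: algebra_simps)
    also have "\<dots> < \<epsilon>\<^sup>2 * (1 / 2)"
    proof (rule mult_strict_left_mono)
      show "n / (4 * (1 + n)\<^sup>2) < 1 / 2"
      proof (subst pos_divide_less_eq)
        have "1 / 2 * (4 * (1 + n)\<^sup>2) = 2 + 4 * n + 2 * n\<^sup>2"
          by (simp add: power2_eq_square algebra_simps)
        with n show "n < 1 / 2 * (4 * (1 + n)\<^sup>2)" using zero_le_power2[of n] by linarith
      qed (use n in simp)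
    qed (use \<open>\<epsilon> > 0\<close> in simp)
    finally show ?thesis by (simp add: n_def)
  qed
  \<comment> \<open>The other half of \<open>\<epsilon>\<^sup>2\<close> absorbs the regularization
    cost of the competitor, which is divided by \<open>S\<close>.\<close>
  have "(\<lambda>S. 2 / m * (K / real S)) \<longlonglongrightarrow> 0" by real_asymp
  then have ev: "eventually (\<lambda>S. 2 / m * (K / real S) < \<epsilon>\<^sup>2 / 2) sequentially"
    using \<open>\<epsilon> > 0\<close> by (intro order_tendstoD(2)) auto
  have "eventually (\<lambda>S. \<P>(\<omega> in M. \<bar>ls_svm \<phi> (w S \<omega>, b S \<omega>) \<beta> - \<tau> \<beta>\<bar> > \<epsilon>)
      \<le> (\<Sum>\<alpha>\<in>\<C>. prob (?bQ \<alpha> S) + prob (?bR \<alpha> S))) sequentially"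
    using ev eventually_ge_at_top[of 1]
  proof eventually_elim
    case (elim S)
    have "{\<omega>\<in>space M. \<bar>ls_svm \<phi> (w S \<omega>, b S \<omega>) \<beta> - \<tau> \<beta>\<bar> > \<epsilon>} \<subseteq> (\<Union>\<alpha>\<in>\<C>. ?bQ \<alpha> S \<union> ?bR \<alpha> S)"
    proof (rule ccontr)
      assume "\<not> ?thesis"
      then obtain \<omega> where \<omega>: "\<omega> \<in> space M" and far: "\<bar>ls_svm \<phi> (w S \<omega>, b S \<omega>) \<beta> - \<tau> \<beta>\<bar> > \<epsilon>"
        and good: "\<And>\<alpha>. \<alpha> \<in> \<C> \<Longrightarrow> \<bar>Q \<alpha> S \<omega> - q \<alpha>\<bar> \<le> m \<and> \<bar>R \<alpha> S \<omega>\<bar> \<le> \<delta>"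
        by fastforce
      define d where "d \<alpha> = ls_svm \<phi> (w S \<omega>, b S \<omega>) \<alpha> - ls_svm \<phi> (w0, b0) \<alpha>" for \<alpha>
      have "(d \<beta>)\<^sup>2 \<le> 2 / m * (K / real S + 2 * real (card \<C>) * \<delta>\<^sup>2 / m)"
      proof (rule quadratic_form_bound[OF fin m \<beta>, where q = "\<lambda>\<alpha>. Q \<alpha> S \<omega>" and r = "\<lambda>\<alpha>. R \<alpha> S \<omega>"])
        show "Q \<alpha> S \<omega> \<ge> m" if "\<alpha> \<in> \<C>" for \<alpha> using good[OF that] qm[OF that] by linarith
        show "\<bar>R \<alpha> S \<omega>\<bar> \<le> \<delta>" if "\<alpha> \<in> \<C>" for \<alpha> using good[OF that] by simp
        show "(\<Sum>\<alpha>\<in>\<C>. Q \<alpha> S \<omega> * (d \<alpha>)\<^sup>2 + 2 * d \<alpha> * R \<alpha> S \<omega>) \<le> K / real S"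
          using ls_svm_minimizer_bound[OF fin C _ _ min[OF elim(2) \<omega>], of w0 b0] AT \<omega>
          by (simp add: Q_def R_def d_def K_def y0 cong: sum.cong)
      qed
      also have "\<dots> < \<epsilon>\<^sup>2" using elim(1) small by (simp add: distrib_left)
      finally have "\<bar>d \<beta>\<bar> < \<epsilon>" using \<open>\<epsilon> > 0\<close> abs_le_square_iff[of \<epsilon> "d \<beta>"] by linarith
      with far show False by (simp add: d_def y0 \<beta>)
    qed
    \<comment> \<open>Monotonicity asks only the covering set to be measurable, and it is built from
      the measurable averages \<open>Q\<close> and \<open>R\<close>.\<close>
    then have "\<P>(\<omega> in M. \<bar>ls_svm \<phi> (w S \<omega>, b S \<omega>) \<beta> - \<tau> \<beta>\<bar> > \<epsilon>) \<le> prob (\<Union>\<alpha>\<in>\<C>. ?bQ \<alpha> S \<union> ?bR \<alpha> S)"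
      using fin by (intro finite_measure_mono sets.finite_UN) auto
    also have "\<dots> \<le> (\<Sum>\<alpha>\<in>\<C>. prob (?bQ \<alpha> S \<union> ?bR \<alpha> S))"
      using fin by (intro measure_UNION_le) auto
    also have "\<dots> \<le> (\<Sum>\<alpha>\<in>\<C>. prob (?bQ \<alpha> S) + prob (?bR \<alpha> S))"
      by (intro sum_mono measure_Un_le) auto
    finally show ?case .
  qed
  moreover have "(\<lambda>S. \<Sum>\<alpha>\<in>\<C>. prob (?bQ \<alpha> S) + prob (?bR \<alpha> S)) \<longlonglongrightarrow> 0"
  proof (rule tendsto_null_sum)
    fix \<alpha> assume \<alpha>: "\<alpha> \<in> \<C>"
    show "(\<lambda>S. prob (?bQ \<alpha> S) + prob (?bR \<alpha> S)) \<longlonglongrightarrow> 0"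
      using limq[OF \<alpha>] limr[OF \<alpha>] m \<delta>
      by (intro tendsto_add_zero) (auto simp: tendsto_in_prob_def Q_def R_def)
  qed
  ultimately show "(\<lambda>S. \<P>(\<omega> in M. \<bar>ls_svm \<phi> (w S \<omega>, b S \<omega>) \<beta> - \<tau> \<beta>\<bar> > \<epsilon>)) \<longlonglongrightarrow> 0"
    by (rule tendsto_sandwich[OF always_eventually _ tendsto_const, rotated 1]) simp
qed

section \<open>Averages over the training sample\<close>

text \<open>Applying \<open>f\<close> preserves both independence and equality of laws, so the weak
  law applies to the \<open>f (Z i)\<close>. A bound on \<open>f (W \<omega>)\<close> suffices
  because the law is shared.\<close>

lemma (in prob_space) empirical_mean_tendsto_in_prob:
  fixes f :: "'x::topological_space \<Rightarrow> real"
  assumes indep: "indep_vars (\<lambda>_. borel) Z {1..}"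
    and distr: "\<And>i. i \<ge> 1 \<Longrightarrow> distr M borel (Z i) = distr M borel W"
    and W[measurable]: "random_variable borel W"
    and f[measurable]: "f \<in> borel_measurable borel"
    and bnd: "\<And>\<omega>. \<omega> \<in> space M \<Longrightarrow> \<bar>f (W \<omega>)\<bar> \<le> B" and "B > 0"
  shows "tendsto_in_prob M (\<lambda>S \<omega>. (\<Sum>i=1..S. f (Z i \<omega>)) / real S) (expectation (\<lambda>\<omega>. f (W \<omega>)))"
proof (rule weak_law_bounded_iid[where l = "-B" and u = B])
  show "indep_vars (\<lambda>_. borel) (\<lambda>i \<omega>. f (Z i \<omega>)) {1..}"
    by (rule indep_vars_compose2[OF indep]) simp
  show "distr M borel (\<lambda>\<omega>. f (Z i \<omega>)) = distr M borel (\<lambda>\<omega>. f (W \<omega>))" if "i \<ge> 1" for i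
  proof -
    have [measurable]: "random_variable borel (Z i)"
      using indep that by (auto simp: indep_vars_def)
    have "distr M borel (\<lambda>\<omega>. f (Z i \<omega>)) = distr (distr M borel (Z i)) borel f"
      by (simp add: distr_distr comp_def)
    also have "\<dots> = distr M borel (\<lambda>\<omega>. f (W \<omega>))"
      by (simp add: distr[OF that] distr_distr comp_def)
    finally show ?thesis .
  qed
  show "AE \<omega> in M. f (W \<omega>) \<in> {-B..B}"
    using bnd by (intro AE_I2) (auto simp: abs_le_iff minus_le_iff)
qed (use \<open>B > 0\<close> in auto)

section \<open>The detection problem and its regression function\<close>

text \<open>In a T1 space singletons are closed, hence Borel, which makes the events
  \<open>a \<omega> = \<alpha>\<close> measurable.\<close>

locale detection_problem = prob_space M
  for M :: "'w measure" +
  fixes \<C> :: "'x::t1_space set" and H :: "'w \<Rightarrow> hypothesis" and a :: "'w \<Rightarrow> 'x"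
  assumes finite_alphabet: "finite \<C>"
    and measurable_H[measurable]: "H \<in> measurable M (count_space UNIV)"
    and measurable_a[measurable]: "a \<in> measurable M borel"
    and a_in_alphabet: "\<And>\<omega>. \<omega> \<in> space M \<Longrightarrow> a \<omega> \<in> \<C>"
    and prior_pos: "\<And>h. \<P>(\<omega> in M. H \<omega> = h) > 0"
    and obs_pmf_pos: "\<And>h \<alpha>. \<alpha> \<in> \<C> \<Longrightarrow> obs_pmf M H a h \<alpha> > 0"
begin

definition joint :: "hypothesis \<Rightarrow> 'x \<Rightarrow> real" where
  "joint h \<alpha> = \<P>(\<omega> in M. a \<omega> = \<alpha> \<and> H \<omega> = h)"

text \<open>The conditional mean of the label given the observation \<open>\<alpha>\<close>.\<close>

definition regression :: "'x \<Rightarrow> real" where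
  "regression \<alpha> = (joint H1 \<alpha> - joint H0 \<alpha>) / (joint H1 \<alpha> + joint H0 \<alpha>)"

lemma measurable_eq_a[measurable]: "Measurable.pred M (\<lambda>\<omega>. a \<omega> = \<alpha>)"
  using measurable_sets[OF measurable_a, of "{\<alpha>}"]
  by (simp add: pred_def vimage_def Int_def conj_commute)

lemma joint_eq: "joint h \<alpha> = \<P>(\<omega> in M. H \<omega> = h) * obs_pmf M H a h \<alpha>"
  using prior_pos[of h] by (simp add: joint_def obs_pmf_def cond_prob_def)

lemma joint_pos: "\<alpha> \<in> \<C> \<Longrightarrow> joint h \<alpha> > 0"
  by (simp add: joint_eq prior_pos obs_pmf_pos)

text \<open>The event splits into finitely many disjoint events
  \<open>a \<omega> = \<alpha>\<close>. Both error probabilities thus become sums over the alphabet,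
  and tests can be compared letter by letter.\<close>

lemma cond_prob_eq_sum_obs_pmf:
  "\<P>(\<omega> in M. g (a \<omega>) = v \<bar> H \<omega> = h) = (\<Sum>\<alpha>\<in>\<C>. if g \<alpha> = v then obs_pmf M H a h \<alpha> else 0)"
proof -
  let ?E = "\<lambda>\<alpha>. {\<omega>\<in>space M. a \<omega> = \<alpha> \<and> H \<omega> = h}"
  have "\<P>(\<omega> in M. g (a \<omega>) = v \<and> H \<omega> = h) = prob (\<Union>\<alpha>\<in>{\<alpha>\<in>\<C>. g \<alpha> = v}. ?E \<alpha>)"
    by (rule arg_cong[where f = prob]) (use a_in_alphabet in auto)
  also have "\<dots> = (\<Sum>\<alpha>\<in>{\<alpha>\<in>\<C>. g \<alpha> = v}. prob (?E \<alpha>))"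
    using finite_alphabet by (intro finite_measure_finite_Union) (auto simp: disjoint_family_on_def)
  also have "\<dots> = (\<Sum>\<alpha>\<in>\<C>. if g \<alpha> = v then prob (?E \<alpha>) else 0)"
    using finite_alphabet by (rule sum.inter_filter)
  finally show ?thesis
    by (simp add: cond_prob_def obs_pmf_def sum_divide_distrib if_distrib[where f = "\<lambda>x. x / _"]
        cong: if_cong)
qed

text \<open>Supplies both limits of the training averages: constant \<open>f\<close> for the letter
  frequencies, \<open>f\<close> the regression value minus the label for the residuals.\<close>

lemma expectation_observation_label:
  fixes f :: "hypothesis \<Rightarrow> real"
  shows "expectation (\<lambda>\<omega>. of_bool (a \<omega> = \<alpha>) * f (H \<omega>)) = f H0 * joint H0 \<alpha> + f H1 * joint H1 \<alpha>"
proof -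
  let ?E = "\<lambda>h. {\<omega>\<in>space M. a \<omega> = \<alpha> \<and> H \<omega> = h}"
  have "of_bool (a \<omega> = \<alpha>) * f (H \<omega>) = f H0 * indicator (?E H0) \<omega> + f H1 * indicator (?E H1) \<omega>"
    if "\<omega> \<in> space M" for \<omega>
    using that by (cases "H \<omega>") auto
  then have "expectation (\<lambda>\<omega>. of_bool (a \<omega> = \<alpha>) * f (H \<omega>))
      = expectation (\<lambda>\<omega>. f H0 * indicator (?E H0) \<omega> + f H1 * indicator (?E H1) \<omega>)"
    by (intro Bochner_Integration.integral_cong) auto
  also have "\<dots> = f H0 * joint H0 \<alpha> + f H1 * joint H1 \<alpha>"
    by (subst Bochner_Integration.integral_add)
       (auto simp: joint_def less_top[symmetric] intro!: integrable_mult_right integrable_real_indicator)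
  finally show ?thesis .
qed

section \<open>Neyman-Pearson form and optimality of threshold tests\<close>

text \<open>With priors \<open>p0\<close>, \<open>p1\<close> and likelihood ratio \<open>L\<close>,
  the regression value is \<open>(p1 - p0 * L) / (p1 + p0 * L)\<close>, which decreases in
  \<open>L\<close>.\<close>

lemma regression_antimono:
  assumes "\<alpha> \<in> \<C>" "\<beta> \<in> \<C>" and le: "log_lr M H a \<beta> \<le> log_lr M H a \<alpha>"
  shows "regression \<alpha> \<le> regression \<beta>"
proof -
  have "obs_pmf M H a H0 \<beta> / obs_pmf M H a H1 \<beta> \<le> obs_pmf M H a H0 \<alpha> / obs_pmf M H a H1 \<alpha>"
    using le assms(1,2) by (simp add: log_lr_def obs_pmf_pos)
  then have "obs_pmf M H a H0 \<beta> * obs_pmf M H a H1 \<alpha> \<le> obs_pmf M H a H0 \<alpha> * obs_pmf M H a H1 \<beta>"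
    using obs_pmf_pos[OF assms(1), of H1] obs_pmf_pos[OF assms(2), of H1]
    by (simp add: pos_divide_le_eq pos_le_divide_eq)
  then have "(\<P>(\<omega> in M. H \<omega> = H0) * \<P>(\<omega> in M. H \<omega> = H1)) * (obs_pmf M H a H0 \<beta> * obs_pmf M H a H1 \<alpha>)
    \<le> (\<P>(\<omega> in M. H \<omega> = H0) * \<P>(\<omega> in M. H \<omega> = H1)) * (obs_pmf M H a H0 \<alpha> * obs_pmf M H a H1 \<beta>)"
    by (intro mult_left_mono) auto
  then have le: "joint H0 \<beta> * joint H1 \<alpha> \<le> joint H0 \<alpha> * joint H1 \<beta>"
    by (simp add: joint_eq mult_ac)
  have pos: "joint H1 \<alpha> + joint H0 \<alpha> > 0" "joint H1 \<beta> + joint H0 \<beta> > 0"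
    using assms by (auto intro!: add_pos_pos joint_pos)
  \<comment> \<open>Over the common denominator, the numerator of the difference is twice the
    difference of the two products in \<open>le\<close>.\<close>
  show ?thesis
    unfolding regression_def frac_le_eq[OF pos(1)[THEN less_imp_neq, symmetric] pos(2)[THEN less_imp_neq, symmetric]]
    using pos le by (intro divide_nonpos_pos mult_pos_pos) (auto simp: algebra_simps)
qed

text \<open>The empty infimum is \<open>\<infinity>\<close>, which covers the test that always decides \<open>H1\<close>.\<close>

lemma threshold_test_regression_eq_np_test:
  "\<exists>\<Lambda>::ereal. \<forall>\<alpha>\<in>\<C>. threshold_test regression \<theta> \<alpha> = np_test M H a \<Lambda> \<alpha>"
proof -
  let ?L = "\<lambda>\<alpha>. ereal (log_lr M H a \<alpha>)"
  define D where "D = {\<alpha>\<in>\<C>. regression \<alpha> \<le> \<theta>}"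
  \<comment> \<open>The smallest log likelihood ratio among the letters that the threshold test
    assigns to \<open>H0\<close>.\<close>
  define \<Lambda> where "\<Lambda> = Inf (?L ` D)"
  have "\<Lambda> \<le> ?L \<alpha> \<longleftrightarrow> regression \<alpha> \<le> \<theta>" if \<alpha>: "\<alpha> \<in> \<C>" for \<alpha>
  proof
    assume le: "\<Lambda> \<le> ?L \<alpha>"
    have "D \<noteq> {}" using le by (auto simp: \<Lambda>_def top_ereal_def)
    moreover have "finite D" using finite_alphabet by (simp add: D_def)
    \<comment> \<open>The infimum over a nonempty finite set is attained, so equality with the
      threshold also leads to the decision \<open>H0\<close>.\<close>
    ultimately have "\<Lambda> \<in> ?L ` D"
      using Min_in[of "?L ` D"] Min_Inf[of "?L ` D"] by (simp add: \<Lambda>_def)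
    then obtain \<beta> where \<beta>: "\<beta> \<in> D" "\<Lambda> = ?L \<beta>" by auto
    then have "regression \<alpha> \<le> regression \<beta>"
      using le \<alpha> by (intro regression_antimono) (auto simp: D_def)
    then show "regression \<alpha> \<le> \<theta>" using \<beta> by (auto simp: D_def)
  qed (use \<alpha> in \<open>auto simp: \<Lambda>_def D_def intro!: Inf_lower\<close>)
  then show ?thesis
    by (intro exI[of _ \<Lambda>]) (auto simp: threshold_test_def np_test_def not_less)
qed

text \<open>For a finite threshold \<open>l\<close> the test minimizes
  \<open>exp l * mis_detection + false_alarm\<close>, so a rival with no more false alarms cannot
  have fewer mis-detections. The two infinite thresholds give constant tests and are treated
  separately.\<close>

lemma np_test_most_powerful:
  assumes f: "\<And>\<alpha>. \<alpha> \<in> \<C> \<Longrightarrow> f \<alpha> = np_test M H a \<Lambda> \<alpha>"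
  shows "most_powerful M H a \<C> f"
  unfolding most_powerful_def
proof (intro conjI allI impI)
  show "is_test \<C> f" by (simp add: is_test_def f np_test_def)
  fix g assume g: "is_test \<C> g \<and> false_alarm M H a g \<le> false_alarm M H a f"
  let ?p0 = "obs_pmf M H a H0" and ?p1 = "obs_pmf M H a H1"
  note FA = false_alarm_def cond_prob_eq_sum_obs_pmf and MD = mis_detection_def cond_prob_eq_sum_obs_pmf
  show "mis_detection M H a f \<le> mis_detection M H a g"
  proof (cases \<Lambda>)
    case (real l)
    \<comment> \<open>The weighted cost is minimized at each letter separately: the test picks the
      cheaper of \<open>exp l * ?p1 \<alpha>\<close> and \<open>?p0 \<alpha>\<close>.\<close>
    have le: "exp l * (if f \<alpha> = -1 then ?p1 \<alpha> else 0) + (if f \<alpha> = 1 then ?p0 \<alpha> else 0)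
        \<le> exp l * (if g \<alpha> = -1 then ?p1 \<alpha> else 0) + (if g \<alpha> = 1 then ?p0 \<alpha> else 0)"
      if \<alpha>: "\<alpha> \<in> \<C>" for \<alpha>
    proof -
      have "\<Lambda> \<le> ereal (log_lr M H a \<alpha>) \<longleftrightarrow> exp l * ?p1 \<alpha> \<le> ?p0 \<alpha>"
        using obs_pmf_pos[OF \<alpha>] by (simp add: real log_lr_def ln_ge_iff pos_le_divide_eq)
      moreover have "g \<alpha> \<in> {-1, 1}" using g \<alpha> by (auto simp: is_test_def)
      ultimately show ?thesis by (auto simp: f[OF \<alpha>] np_test_def)
    qed
    have "exp l * mis_detection M H a f + false_alarm M H a f
        \<le> exp l * mis_detection M H a g + false_alarm M H a g"
      using sum_mono[OF le] unfolding FA MD by (simp add: sum.distrib sum_distrib_left)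
    with g have "exp l * mis_detection M H a f \<le> exp l * mis_detection M H a g" by linarith
    then show ?thesis by simp
  next
    case PInf
    then have "f \<alpha> = 1" if "\<alpha> \<in> \<C>" for \<alpha> using that by (simp add: f np_test_def)
    then have "mis_detection M H a f = 0" by (simp add: MD)
    then show ?thesis by (simp add: MD sum_nonneg less_imp_le obs_pmf_pos)
  next
    case MInf
    then have f1: "f \<alpha> = -1" if "\<alpha> \<in> \<C>" for \<alpha> using that by (simp add: f np_test_def)
    \<comment> \<open>A test that always decides \<open>H0\<close> has no false alarms. Since
      \<open>?p0\<close> is positive on the alphabet, the rival must then also decide
      \<open>H0\<close> at every letter.\<close>
    then have "(\<Sum>\<alpha>\<in>\<C>. if g \<alpha> = 1 then ?p0 \<alpha> else 0) \<le> 0" using g by (simp add: FA)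
    then have "(\<Sum>\<alpha>\<in>\<C>. if g \<alpha> = 1 then ?p0 \<alpha> else 0) = 0"
      by (intro antisym sum_nonneg) (auto simp: less_imp_le obs_pmf_pos)
    then have "\<forall>\<alpha>\<in>\<C>. (if g \<alpha> = 1 then ?p0 \<alpha> else 0) = 0"
      by (subst (asm) sum_nonneg_eq_0_iff) (auto simp: finite_alphabet less_imp_le obs_pmf_pos)
    then have "g \<alpha> = -1" if "\<alpha> \<in> \<C>" for \<alpha>
      using that g obs_pmf_pos[OF that, of H0] by (auto simp: is_test_def split: if_splits)
    then show ?thesis by (simp add: MD f1)
  qed
qed

end

section \<open>The limit of training and the optimality of its threshold test\<close>

text \<open>The limit function is determined only on \<open>\<C>\<close>; hence its existence is
  asserted first, and the claim about the test is then made for every function that is a limit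
  there.\<close>

theorem theorem3:
  fixes M :: "'w measure"
    and \<C> :: "(real^'n) set"
    and H :: "'w \<Rightarrow> hypothesis" and a :: "'w \<Rightarrow> real^'n"
    and A :: "nat \<Rightarrow> 'w \<Rightarrow> real^'n" and T :: "nat \<Rightarrow> 'w \<Rightarrow> real"
    and \<phi> :: "real^'n \<Rightarrow> real^'k" and C :: real
    and w :: "nat \<Rightarrow> 'w \<Rightarrow> real^'k" and b :: "nat \<Rightarrow> 'w \<Rightarrow> real"
    and \<theta> :: real
  assumes "prob_space M"
    and "finite \<C>"
    and "H \<in> measurable M (count_space UNIV)"
    and "a \<in> measurable M borel"
    and "\<And>\<omega>. \<omega> \<in> space M \<Longrightarrow> a \<omega> \<in> \<C>"
    and "\<And>h. \<P>(\<omega> in M. H \<omega> = h) > 0"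
    and "\<And>h \<alpha>. \<alpha> \<in> \<C> \<Longrightarrow> obs_pmf M H a h \<alpha> > 0"
    and "\<And>i \<omega>. i \<ge> 1 \<Longrightarrow> \<omega> \<in> space M \<Longrightarrow> A i \<omega> \<in> \<C> \<and> T i \<omega> \<in> {-1, 1}"
    and "prob_space.indep_vars M (\<lambda>_. borel) (\<lambda>i \<omega>. (A i \<omega>, T i \<omega>)) {1..}"
    and "\<And>i. i \<ge> 1 \<Longrightarrow>
           distr M borel (\<lambda>\<omega>. (A i \<omega>, T i \<omega>)) = distr M borel (\<lambda>\<omega>. (a \<omega>, label (H \<omega>)))"
    and "C > 0"
    and "sufficiently_complex \<phi> \<C>"
    and "\<And>S. S \<ge> 1 \<Longrightarrow> w S \<in> measurable M borel"
    and "\<And>S. S \<ge> 1 \<Longrightarrow> b S \<in> measurable M borel"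
    and "\<And>S \<omega>. S \<ge> 1 \<Longrightarrow> \<omega> \<in> space M \<Longrightarrow>
           is_arg_min (ls_svm_objective \<phi> C S (\<lambda>i. A i \<omega>) (\<lambda>i. T i \<omega>)) (\<lambda>_. True) (w S \<omega>, b S \<omega>)"
  shows "(\<exists>t. \<forall>\<alpha>\<in>\<C>. tendsto_in_prob M (\<lambda>S \<omega>. ls_svm \<phi> (w S \<omega>, b S \<omega>) \<alpha>) (t \<alpha>)) \<and>
    (\<forall>t. (\<forall>\<alpha>\<in>\<C>. tendsto_in_prob M (\<lambda>S \<omega>. ls_svm \<phi> (w S \<omega>, b S \<omega>) \<alpha>) (t \<alpha>)) \<longrightarrow>
      (\<exists>\<Lambda>::ereal. \<forall>\<alpha>\<in>\<C>. threshold_test t \<theta> \<alpha> = np_test M H a \<Lambda> \<alpha>) \<and>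
      most_powerful M H a \<C> (threshold_test t \<theta>))"
proof -
  interpret detection_problem M \<C> H a
    by (intro detection_problem.intro detection_problem_axioms.intro) fact+
  let ?y = "\<lambda>S \<omega>. ls_svm \<phi> (w S \<omega>, b S \<omega>)"
  obtain w0 b0 where y0: "\<And>\<alpha>. \<alpha> \<in> \<C> \<Longrightarrow> regression \<alpha> = ls_svm \<phi> (w0, b0) \<alpha>"
    using assms(12) unfolding sufficiently_complex_def by blast
  have Z: "random_variable borel (\<lambda>\<omega>. (A i \<omega>, T i \<omega>))" if "i \<ge> 1" for i
    using assms(9) that by (auto simp: indep_vars_def)
  have [measurable]: "A i \<in> borel_measurable M" "T i \<in> borel_measurable M" if "i \<ge> 1" for i
    using measurable_compose[OF Z[OF that], of fst borel] measurable_compose[OF Z[OF that], of snd borel]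
    by (simp_all add: borel_prod[symmetric])
  have [measurable]: "random_variable borel (\<lambda>\<omega>. label (H \<omega>))"
    by (rule measurable_compose[OF measurable_H]) simp
  have W: "random_variable borel (\<lambda>\<omega>. (a \<omega>, label (H \<omega>)))"
    unfolding borel_prod[symmetric] by measurable
  note mean = empirical_mean_tendsto_in_prob[OF assms(9,10) W]
  have lim: "tendsto_in_prob M (\<lambda>S \<omega>. ?y S \<omega> \<alpha>) (regression \<alpha>)" if "\<alpha> \<in> \<C>" for \<alpha>
  proof (rule ls_svm_tendsto_in_prob[OF assms(1,2) assms(11) assms(8) assms(15), where ?w0.0 = w0 and ?b0.0 = b0
        and q = "\<lambda>\<alpha>. joint H0 \<alpha> + joint H1 \<alpha>"])
    show "tendsto_in_prob M (\<lambda>S \<omega>. (\<Sum>i=1..S. of_bool (A i \<omega> = \<alpha>)) / real S) (joint H0 \<alpha> + joint H1 \<alpha>)"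
      if "\<alpha> \<in> \<C>" for \<alpha>
    proof -
      have "(\<lambda>z. of_bool (fst z = \<alpha>)) \<in> borel_measurable (borel :: ((real^'n) \<times> real) measure)"
        unfolding borel_prod[symmetric] by measurable
      from mean[OF _ this, of 1] expectation_observation_label[of \<alpha> "\<lambda>_. 1"]
      show ?thesis by simp
    qed
    show "tendsto_in_prob M (\<lambda>S \<omega>. (\<Sum>i=1..S. of_bool (A i \<omega> = \<alpha>) * (regression \<alpha> - T i \<omega>)) / real S) 0"
      if \<alpha>: "\<alpha> \<in> \<C>" for \<alpha>
    proof -
      have *: "(\<lambda>z. of_bool (fst z = \<alpha>) * (regression \<alpha> - snd z))
          \<in> borel_measurable (borel :: ((real^'n) \<times> real) measure)"
        unfolding borel_prod[symmetric] by measurable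
      \<comment> \<open>The residual has mean zero on each letter because \<open>regression\<close>
        is the conditional mean of the label.\<close>
      have "expectation (\<lambda>\<omega>. of_bool (a \<omega> = \<alpha>) * (regression \<alpha> - label (H \<omega>))) = 0"
        using joint_pos[OF \<alpha>, of H0] joint_pos[OF \<alpha>, of H1]
        by (subst expectation_observation_label) (simp add: regression_def field_simps)
      moreover have "\<bar>label h\<bar> = 1" for h by (cases h) auto
      then have "\<bar>of_bool (x = \<alpha>) * (regression \<alpha> - label h)\<bar> \<le> \<bar>regression \<alpha>\<bar> + 1" for x h
        using abs_triangle_ineq4[of "regression \<alpha>" "label h"] by (auto simp: of_bool_def)
      ultimately show ?thesis
        using mean[OF _ *, of "\<bar>regression \<alpha>\<bar> + 1"] by simp
    qed
  qed (use that y0 in \<open>auto intro!: add_pos_pos joint_pos\<close>)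
  have meas: "random_variable borel (\<lambda>\<omega>. ?y S \<omega> \<alpha>)" if "S \<ge> 1" for S \<alpha>
    using assms(13,14)[OF that] by (simp add: ls_svm_def)
  show ?thesis
  proof (intro conjI allI impI)
    show "\<exists>t. \<forall>\<alpha>\<in>\<C>. tendsto_in_prob M (\<lambda>S \<omega>. ?y S \<omega> \<alpha>) (t \<alpha>)" using lim by blast
    fix t assume t: "\<forall>\<alpha>\<in>\<C>. tendsto_in_prob M (\<lambda>S \<omega>. ?y S \<omega> \<alpha>) (t \<alpha>)"
    \<comment> \<open>Uniqueness of limits transfers the Neyman-Pearson form from
      \<open>regression\<close> to any limit \<open>t\<close> on the alphabet.\<close>
    have "t \<alpha> = regression \<alpha>" if "\<alpha> \<in> \<C>" for \<alpha>
      by (rule tendsto_in_prob_unique[OF meas t[rule_format, OF that] lim[OF that]])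
    then obtain \<Lambda> :: ereal where \<Lambda>: "\<forall>\<alpha>\<in>\<C>. threshold_test t \<theta> \<alpha> = np_test M H a \<Lambda> \<alpha>"
      using threshold_test_regression_eq_np_test[of \<theta>] by (auto simp: threshold_test_def)
    then show "\<exists>\<Lambda>::ereal. \<forall>\<alpha>\<in>\<C>. threshold_test t \<theta> \<alpha> = np_test M H a \<Lambda> \<alpha>" by blast
    show "most_powerful M H a \<C> (threshold_test t \<theta>)"
      using \<Lambda> by (intro np_test_most_powerful) auto
  qed
qed

end
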